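(* Almost paracontact metric 3-dimensional Walker manifolds are never para-Sasakian (equivalently, never K-paracontact metric).
   Context: An almost paracontact metric structure on a $(2n+1)$-dimensional manifold $M$ is a quadruple $(\varphi,\xi,\eta,g)$ ($\varphi$ an endomorphism of $TM$, $\xi$ a vector field, $\eta$ a 1-form, $g$ a pseudo-Riemannian metric) with $\varphi^2=\mathrm{Id}-\eta\otimes\xi$, $\eta(\xi)=1$, $\varphi\xi=0$; the $\pm1$-eigensubbundles of $\varphi|_{\operatorname{Ker}\eta}$ both have dimension $n$; and $g(\varphi X,\varphi Y)=-g(X,Y)+\eta(X)\eta(Y)$. An almost paracontact metric 3-dimensional Walker manifold $(M,\varphi,\xi,\eta,g)$ is a 3-manifold with coordinates $(x,y,z)$, $f\in C^\infty(M)$, and, with respect to $\{\partial_x,\partial_y,\partial_z\}$, $$g=\begin{pmatrix}0&0&1\\0&1&0\\1&0&f\end{pmatrix},\quad \varphi=\begin{pmatrix}-\xi_2&\xi_1+f\xi_3&-f\xi_2\\ \xi_3&0&-\xi_1\\0&-\xi_3&\xi_2\end{pmatrix},$$ $\xi=\xi_1\partial_x+\xi_2\partial_y+\xi_3\partial_z$, $\eta=\xi_3dx+\xi_2dy+(\xi_1+f\xi_3)dz$, where $\xi_1,\xi_2,\xi_3\in C^\infty(M)$ satisfy $\xi_2^2+f\xi_3^2+2\xi_1\xi_3=1$ (columns of $\varphi$ are the images of the basis vectors). Let $\phi(X,Y)=g(\varphi X,Y)$ and $d\eta(X,Y)=\frac12((\nabla_X\eta)Y-(\nabla_Y\eta)X)$,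 $\nabla$ the Levi-Civita connection. The structure is paracontact metric if $\phi=d\eta$; normal if $N(X,Y)-2d\eta(X,Y)\xi=0$, where $N(X,Y)=\varphi^2[X,Y]+[\varphi X,\varphi Y]-\varphi[\varphi X,Y]-\varphi[X,\varphi Y]$; para-Sasakian if it is normal and paracontact metric; K-paracontact if it is paracontact metric and $\xi$ is a Killing vector field. It is known that in dimension 3 para-Sasakian and K-paracontact metric are equivalent, both being characterized by $g((\nabla_X\varphi)Y,Z)=\eta(Y)g(\varphi X,\varphi Z)-\eta(Z)g(\varphi X,\varphi Y)$. *)

theory Defs
  imports "HOL-Analysis.Analysis"
begin

section \<open>Calculus on an open subset of coordinate space\<close>

text \<open>
  All tensor fields live on an open set \<open>U\<close> of \<open>real ^ 'n\<close>, the image of the coordinate chart;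
  they are total functions whose values off \<open>U\<close> are irrelevant, since every condition below is
  imposed at points of \<open>U\<close> only and derivatives at such points are local.
\<close>

definition dir_deriv :: "(real^'n \<Rightarrow> real^'n) \<Rightarrow> (real^'n \<Rightarrow> real) \<Rightarrow> real^'n \<Rightarrow> real" where
  "dir_deriv X h = (\<lambda>p. frechet_derivative h (at p) (X p))"

definition partial_deriv :: "'n \<Rightarrow> (real^'n \<Rightarrow> real) \<Rightarrow> real^'n \<Rightarrow> real" where
  "partial_deriv i h = (\<lambda>p. frechet_derivative h (at p) (axis i 1))"

primrec Ck_on :: "nat \<Rightarrow> (real^'n) set \<Rightarrow> (real^'n \<Rightarrow> real) \<Rightarrow> bool" where
  "Ck_on 0 U h \<longleftrightarrow> continuous_on U h"
| "Ck_on (Suc k) U h \<longleftrightarrow> h differentiable_on U \<and> (\<forall>i. Ck_on k U (partial_deriv i h))"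

definition smooth_on :: "(real^'n) set \<Rightarrow> (real^'n \<Rightarrow> real) \<Rightarrow> bool" where
  "smooth_on U h \<longleftrightarrow> (\<forall>k. Ck_on k U h)"

definition smooth_vf :: "(real^'n) set \<Rightarrow> (real^'n \<Rightarrow> real^'n) \<Rightarrow> bool" where
  "smooth_vf U X \<longleftrightarrow> (\<forall>i. smooth_on U (\<lambda>p. X p $ i))"

definition smooth_mf :: "(real^'n) set \<Rightarrow> (real^'n \<Rightarrow> real^'n^'n) \<Rightarrow> bool" where
  "smooth_mf U A \<longleftrightarrow> (\<forall>i j. smooth_on U (\<lambda>p. A p $ i $ j))"

definition lie_bracket :: "(real^'n \<Rightarrow> real^'n) \<Rightarrow> (real^'n \<Rightarrow> real^'n) \<Rightarrow> real^'n \<Rightarrow> real^'n" where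
  "lie_bracket X Y = (\<lambda>p. \<chi> k. dir_deriv X (\<lambda>q. Y q $ k) p - dir_deriv Y (\<lambda>q. X q $ k) p)"

text \<open>
  A bilinear form field is given by its Gram matrix, an endomorphism field by the matrix whose
  columns are the images of the coordinate fields, a 1-form by its coefficient vector.
\<close>

definition form2 :: "(real^'n \<Rightarrow> real^'n^'n) \<Rightarrow> (real^'n \<Rightarrow> real^'n) \<Rightarrow> (real^'n \<Rightarrow> real^'n) \<Rightarrow> real^'n \<Rightarrow> real" where
  "form2 g X Y = (\<lambda>p. X p \<bullet> (g p *v Y p))"

definition endo :: "(real^'n \<Rightarrow> real^'n^'n) \<Rightarrow> (real^'n \<Rightarrow> real^'n) \<Rightarrow> real^'n \<Rightarrow> real^'n" where
  "endo A X = (\<lambda>p. A p *v X p)"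

definition form1 :: "(real^'n \<Rightarrow> real^'n) \<Rightarrow> (real^'n \<Rightarrow> real^'n) \<Rightarrow> real^'n \<Rightarrow> real" where
  "form1 \<eta> X = (\<lambda>p. \<eta> p \<bullet> X p)"


section \<open>Pseudo-Riemannian metrics and the Levi-Civita connection\<close>

definition pseudo_riemannian :: "(real^'n) set \<Rightarrow> (real^'n \<Rightarrow> real^'n^'n) \<Rightarrow> bool" where
  "pseudo_riemannian U g \<longleftrightarrow>
     smooth_mf U g \<and> (\<forall>p\<in>U. transpose (g p) = g p \<and> invertible (g p))"

definition christoffel :: "(real^'n \<Rightarrow> real^'n^'n) \<Rightarrow> 'n \<Rightarrow> 'n \<Rightarrow> 'n \<Rightarrow> real^'n \<Rightarrow> real" where
  "christoffel g k i j = (\<lambda>p. 1/2 * (\<Sum>l\<in>UNIV. matrix_inv (g p) $ k $ l *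
       (partial_deriv i (\<lambda>q. g q $ j $ l) p + partial_deriv j (\<lambda>q. g q $ i $ l) p
        - partial_deriv l (\<lambda>q. g q $ i $ j) p)))"

definition levi_civita ::
  "(real^'n \<Rightarrow> real^'n^'n) \<Rightarrow> (real^'n \<Rightarrow> real^'n) \<Rightarrow> (real^'n \<Rightarrow> real^'n) \<Rightarrow> real^'n \<Rightarrow> real^'n" where
  "levi_civita g X Y = (\<lambda>p. \<chi> k. dir_deriv X (\<lambda>q. Y q $ k) p
       + (\<Sum>i\<in>UNIV. \<Sum>j\<in>UNIV. christoffel g k i j p * X p $ i * Y p $ j))"

text \<open>
  The two characteristic properties of the Levi-Civita connection: it is torsion-free and
  compatible with the metric.
\<close>

lemma smooth_on_differentiable:
  assumes "open U" "smooth_on U h" "p \<in> U"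
  shows "h differentiable (at p)"
proof -
  have "Ck_on (Suc 0) U h" using assms(2) unfolding smooth_on_def by blast
  then show ?thesis using assms(1,3) by (simp add: differentiable_on_eq_differentiable_at)
qed

lemma dir_deriv_partial:
  assumes "h differentiable (at p)"
  shows "dir_deriv X h p = (\<Sum>i\<in>UNIV. X p $ i * partial_deriv i h p)"
proof -
  have lin: "linear (frechet_derivative h (at p))"
    using assms by (rule linear_frechet_derivative)
  have "X p = (\<Sum>i\<in>UNIV. X p $ i *\<^sub>R axis i 1)"
    using basis_expansion[of "X p"] by (simp add: scalar_mult_eq_scaleR)
  then have "dir_deriv X h p = frechet_derivative h (at p) (\<Sum>i\<in>UNIV. X p $ i *\<^sub>R axis i 1)"
    by (simp add: dir_deriv_def)
  then show ?thesis
    by (simp add: linear_sum[OF lin] linear_cmul[OF lin] partial_deriv_def)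
qed

lemma transpose_entry:
  assumes "transpose A = A"
  shows "A $ i $ j = A $ j $ i"
  using assms by (metis transpose_def vec_lambda_beta)

lemma partial_deriv_sym:
  assumes "open U" "pseudo_riemannian U g" "p \<in> U"
  shows "partial_deriv l (\<lambda>q. g q $ i $ j) p = partial_deriv l (\<lambda>q. g q $ j $ i) p"
proof -
  have d: "(\<lambda>q. g q $ i $ j) differentiable (at p)" for i j
    using assms smooth_on_differentiable unfolding pseudo_riemannian_def smooth_mf_def by blast
  have "((\<lambda>q. g q $ i $ j) has_derivative frechet_derivative (\<lambda>q. g q $ i $ j) (at p)) (at p)"
    using d frechet_derivative_works by blast
  then have "((\<lambda>q. g q $ j $ i) has_derivative frechet_derivative (\<lambda>q. g q $ i $ j) (at p)) (at p)"
    by (rule has_derivative_transform_within_open[OF _ assms(1,3)])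
      (use assms(2) transpose_entry in \<open>unfold pseudo_riemannian_def, blast\<close>)
  then show ?thesis
    unfolding partial_deriv_def using frechet_derivative_at by metis
qed

lemma christoffel_sym:
  assumes "open U" "pseudo_riemannian U g" "p \<in> U"
  shows "christoffel g k i j p = christoffel g k j i p"
  unfolding christoffel_def
  using partial_deriv_sym[OF assms, of _ i j] by (simp add: algebra_simps)

lemma levi_civita_torsion_free:
  assumes "open U" "pseudo_riemannian U g" "p \<in> U"
  shows "levi_civita g X Y p - levi_civita g Y X p = lie_bracket X Y p"
proof -
  have "(\<Sum>i\<in>UNIV. \<Sum>j\<in>UNIV. christoffel g k i j p * X p $ i * Y p $ j)
      = (\<Sum>i\<in>UNIV. \<Sum>j\<in>UNIV. christoffel g k i j p * Y p $ i * X p $ j)" for k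
    by (subst sum.swap, intro sum.cong refl) (metis christoffel_sym[OF assms, of k] mult.assoc mult.commute)
  then show ?thesis
    by (simp add: levi_civita_def lie_bracket_def vec_eq_iff)
qed

lemma christoffel_lower:
  assumes "open U" "pseudo_riemannian U g" "p \<in> U"
  shows "(\<Sum>k\<in>UNIV. g p $ m $ k * christoffel g k i j p)
     = 1/2 * (partial_deriv i (\<lambda>q. g q $ j $ m) p + partial_deriv j (\<lambda>q. g q $ i $ m) p
        - partial_deriv m (\<lambda>q. g q $ i $ j) p)"
proof -
  define c where "c l = partial_deriv i (\<lambda>q. g q $ j $ l) p + partial_deriv j (\<lambda>q. g q $ i $ l) p
        - partial_deriv l (\<lambda>q. g q $ i $ j) p" for l
  have "invertible (g p)" using assms unfolding pseudo_riemannian_def by blast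
  then have inv: "g p ** matrix_inv (g p) = mat 1"
    unfolding invertible_def matrix_inv_def by (rule someI2_ex) simp
  have e: "(\<Sum>k\<in>UNIV. g p $ m $ k * matrix_inv (g p) $ k $ l) = (if m = l then 1 else 0)" for l
    using arg_cong[OF inv, of "\<lambda>A. A $ m $ l"] by (simp add: matrix_matrix_mult_def mat_def)
  have "(\<Sum>k\<in>UNIV. g p $ m $ k * christoffel g k i j p)
      = (\<Sum>k\<in>UNIV. \<Sum>l\<in>UNIV. 1/2 * c l * (g p $ m $ k * matrix_inv (g p) $ k $ l))"
    unfolding christoffel_def c_def[symmetric] by (simp add: sum_distrib_left mult_ac)
  also have "\<dots> = (\<Sum>l\<in>UNIV. 1/2 * c l * (\<Sum>k\<in>UNIV. g p $ m $ k * matrix_inv (g p) $ k $ l))"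
    by (subst sum.swap) (simp add: sum_distrib_left)
  also have "\<dots> = 1/2 * c m"
    unfolding e by (simp add: if_distrib cong: if_cong)
  finally show ?thesis by (simp add: c_def)
qed

lemma levi_civita_metric:
  assumes "open U" "pseudo_riemannian U g" "smooth_vf U Y" "smooth_vf U Z" "p \<in> U"
  shows "dir_deriv X (form2 g Y Z) p
       = form2 g (levi_civita g X Y) Z p + form2 g Y (levi_civita g X Z) p"
proof -
  have dg: "(\<lambda>q. g q $ i $ j) differentiable (at p)" for i j
    using assms smooth_on_differentiable unfolding pseudo_riemannian_def smooth_mf_def by blast
  have dY: "(\<lambda>q. Y q $ i) differentiable (at p)" and dZ: "(\<lambda>q. Z q $ i) differentiable (at p)" for i
    using assms smooth_on_differentiable unfolding smooth_vf_def by blast+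
  have sym: "g p $ i $ j = g p $ j $ i" for i j
    using assms transpose_entry unfolding pseudo_riemannian_def by blast
  define G where "G i j = dir_deriv X (\<lambda>q. g q $ i $ j) p" for i j
  define y where "y = (\<chi> k. dir_deriv X (\<lambda>q. Y q $ k) p)"
  define z where "z = (\<chi> k. dir_deriv X (\<lambda>q. Z q $ k) p)"
  define c where "c V = (\<chi> k. \<Sum>i\<in>UNIV. \<Sum>j\<in>UNIV. christoffel g k i j p * X p $ i * V p $ j)" for V
  define L where "L m a b = (\<Sum>k\<in>UNIV. g p $ m $ k * christoffel g k a b p)" for m a b
  have form2_sum: "form2 g Y Z = (\<lambda>q. \<Sum>i\<in>UNIV. \<Sum>j\<in>UNIV. Y q $ i * (g q $ i $ j * Z q $ j))"
    by (simp add: form2_def inner_vec_def matrix_vector_mult_def sum_distrib_left)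
  note D = dg[unfolded frechet_derivative_works] dY[unfolded frechet_derivative_works]
    dZ[unfolded frechet_derivative_works]
  have "(form2 g Y Z has_derivative (\<lambda>v. \<Sum>i\<in>UNIV. \<Sum>j\<in>UNIV.
      Y p $ i * (g p $ i $ j * frechet_derivative (\<lambda>q. Z q $ j) (at p) v
        + frechet_derivative (\<lambda>q. g q $ i $ j) (at p) v * Z p $ j)
      + frechet_derivative (\<lambda>q. Y q $ i) (at p) v * (g p $ i $ j * Z p $ j))) (at p)"
    unfolding form2_sum by (intro has_derivative_sum has_derivative_mult D)
  from frechet_derivative_at[OF this, symmetric]
  have "dir_deriv X (form2 g Y Z) p = (\<Sum>i\<in>UNIV. \<Sum>j\<in>UNIV.
      Y p $ i * (g p $ i $ j * z $ j + G i j * Z p $ j) + y $ i * (g p $ i $ j * Z p $ j))"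
    by (simp add: dir_deriv_def y_def z_def G_def)
  also have "\<dots> = Y p \<bullet> (g p *v z) + (\<Sum>i\<in>UNIV. \<Sum>j\<in>UNIV. Y p $ i * (G i j * Z p $ j))
      + y \<bullet> (g p *v Z p)"
    by (simp add: inner_vec_def matrix_vector_mult_def sum_distrib_left distrib_left sum.distrib)
  also have "(\<Sum>i\<in>UNIV. \<Sum>j\<in>UNIV. Y p $ i * (G i j * Z p $ j))
      = c Y \<bullet> (g p *v Z p) + Y p \<bullet> (g p *v c Z)"
  proof -
    have low: "g p *v c V = (\<chi> m. \<Sum>a\<in>UNIV. \<Sum>b\<in>UNIV. L m a b * X p $ a * V p $ b)" for V
    proof -
      have "(\<Sum>k\<in>UNIV. g p $ m $ k * (\<Sum>a\<in>UNIV. \<Sum>b\<in>UNIV. christoffel g k a b p * X p $ a * V p $ b))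
        = (\<Sum>a\<in>UNIV. \<Sum>b\<in>UNIV. L m a b * X p $ a * V p $ b)" for m
      proof -
        have "(\<Sum>k\<in>UNIV. g p $ m $ k * (\<Sum>a\<in>UNIV. \<Sum>b\<in>UNIV. christoffel g k a b p * X p $ a * V p $ b))
          = (\<Sum>k\<in>UNIV. \<Sum>a\<in>UNIV. \<Sum>b\<in>UNIV. g p $ m $ k * christoffel g k a b p * X p $ a * V p $ b)"
          by (simp add: sum_distrib_left mult.assoc)
        also have "\<dots> = (\<Sum>a\<in>UNIV. \<Sum>b\<in>UNIV. \<Sum>k\<in>UNIV. g p $ m $ k * christoffel g k a b p * X p $ a * V p $ b)"
          by (rule trans[OF sum.swap sum.cong[OF refl sum.swap]])
        finally show ?thesis by (simp add: L_def sum_distrib_right)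
      qed
      then show ?thesis by (simp add: c_def matrix_vector_mult_def vec_eq_iff)
    qed
    have adj: "c Y \<bullet> (g p *v Z p) = Z p \<bullet> (g p *v c Y)"
      using assms(2,5) unfolding pseudo_riemannian_def
      by (metis dot_lmul_matrix inner_commute transpose_matrix_vector)
    have LG: "(\<Sum>a\<in>UNIV. (L j a i + L i a j) * X p $ a) = G i j" for i j
    proof -
      have "L j a i + L i a j = partial_deriv a (\<lambda>q. g q $ i $ j) p" for a
        unfolding L_def christoffel_lower[OF assms(1,2,5)]
        using partial_deriv_sym[OF assms(1,2,5), of a i j] by (simp add: field_simps)
      then show ?thesis
        by (simp add: G_def dir_deriv_partial[OF dg] mult.commute)
    qed
    have "Z p \<bullet> (g p *v c Y) = (\<Sum>j\<in>UNIV. \<Sum>a\<in>UNIV. \<Sum>i\<in>UNIV. Y p $ i * (L j a i * X p $ a * Z p $ j))"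
      unfolding low by (simp add: inner_vec_def sum_distrib_left mult_ac)
    also have "\<dots> = (\<Sum>i\<in>UNIV. \<Sum>j\<in>UNIV. \<Sum>a\<in>UNIV. Y p $ i * (L j a i * X p $ a * Z p $ j))"
      by (rule trans[OF sum.cong[OF refl sum.swap] sum.swap])
    finally have 1: "Z p \<bullet> (g p *v c Y)
      = (\<Sum>i\<in>UNIV. \<Sum>j\<in>UNIV. \<Sum>a\<in>UNIV. Y p $ i * (L j a i * X p $ a * Z p $ j))" .
    have "Y p \<bullet> (g p *v c Z) = (\<Sum>i\<in>UNIV. \<Sum>a\<in>UNIV. \<Sum>j\<in>UNIV. Y p $ i * (L i a j * X p $ a * Z p $ j))"
      unfolding low by (simp add: inner_vec_def sum_distrib_left mult_ac)
    also have "\<dots> = (\<Sum>i\<in>UNIV. \<Sum>j\<in>UNIV. \<Sum>a\<in>UNIV. Y p $ i * (L i a j * X p $ a * Z p $ j))"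
      by (rule sum.cong[OF refl sum.swap])
    finally have 2: "Y p \<bullet> (g p *v c Z)
      = (\<Sum>i\<in>UNIV. \<Sum>j\<in>UNIV. \<Sum>a\<in>UNIV. Y p $ i * (L i a j * X p $ a * Z p $ j))" .
    show ?thesis
      unfolding adj 1 2 LG[symmetric]
      by (simp add: sum.distrib[symmetric] sum_distrib_left sum_distrib_right algebra_simps)
  qed
  finally have "dir_deriv X (form2 g Y Z) p
    = (y + c Y) \<bullet> (g p *v Z p) + Y p \<bullet> (g p *v (z + c Z))"
    by (simp add: inner_add_left inner_add_right matrix_vector_right_distrib)
  moreover have "levi_civita g X Y p = y + c Y" "levi_civita g X Z p = z + c Z"
    by (simp_all add: levi_civita_def y_def z_def c_def vec_eq_iff)
  ultimately show ?thesis by (simp add: form2_def)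
qed


section \<open>Almost paracontact metric structures\<close>

definition almost_paracontact_metric ::
  "(real^'n) set \<Rightarrow> (real^'n \<Rightarrow> real^'n^'n) \<Rightarrow> (real^'n \<Rightarrow> real^'n) \<Rightarrow> (real^'n \<Rightarrow> real^'n)
    \<Rightarrow> (real^'n \<Rightarrow> real^'n^'n) \<Rightarrow> bool" where
  "almost_paracontact_metric U \<phi> \<xi> \<eta> g \<longleftrightarrow>
     smooth_mf U \<phi> \<and> smooth_vf U \<xi> \<and> smooth_vf U \<eta> \<and> pseudo_riemannian U g \<and>
     (\<forall>p\<in>U. (\<forall>v. \<phi> p *v (\<phi> p *v v) = v - (\<eta> p \<bullet> v) *\<^sub>R \<xi> p) \<and>
        \<eta> p \<bullet> \<xi> p = 1 \<and> \<phi> p *v \<xi> p = 0 \<and>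
        (\<exists>n. CARD('n) = 2 * n + 1 \<and>
             dim {v. \<eta> p \<bullet> v = 0 \<and> \<phi> p *v v = v} = n \<and>
             dim {v. \<eta> p \<bullet> v = 0 \<and> \<phi> p *v v = - v} = n) \<and>
        (\<forall>v w. (\<phi> p *v v) \<bullet> (g p *v (\<phi> p *v w)) = - (v \<bullet> (g p *v w)) + (\<eta> p \<bullet> v) * (\<eta> p \<bullet> w)))"

text \<open>\<open>(\<nabla>\<^sub>X \<eta>) Y = X (\<eta> Y) - \<eta> (\<nabla>\<^sub>X Y)\<close>\<close>

definition nabla_form1 ::
  "(real^'n \<Rightarrow> real^'n^'n) \<Rightarrow> (real^'n \<Rightarrow> real^'n) \<Rightarrow> (real^'n \<Rightarrow> real^'n) \<Rightarrow> (real^'n \<Rightarrow> real^'n)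
    \<Rightarrow> real^'n \<Rightarrow> real" where
  "nabla_form1 g \<eta> X Y = (\<lambda>p. dir_deriv X (form1 \<eta> Y) p - form1 \<eta> (levi_civita g X Y) p)"

definition d_form1 ::
  "(real^'n \<Rightarrow> real^'n^'n) \<Rightarrow> (real^'n \<Rightarrow> real^'n) \<Rightarrow> (real^'n \<Rightarrow> real^'n) \<Rightarrow> (real^'n \<Rightarrow> real^'n)
    \<Rightarrow> real^'n \<Rightarrow> real" where
  "d_form1 g \<eta> X Y = (\<lambda>p. 1/2 * (nabla_form1 g \<eta> X Y p - nabla_form1 g \<eta> Y X p))"

definition fundamental_form ::
  "(real^'n \<Rightarrow> real^'n^'n) \<Rightarrow> (real^'n \<Rightarrow> real^'n^'n) \<Rightarrow> (real^'n \<Rightarrow> real^'n) \<Rightarrow> (real^'n \<Rightarrow> real^'n)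
    \<Rightarrow> real^'n \<Rightarrow> real" where
  "fundamental_form \<phi> g X Y = form2 g (endo \<phi> X) Y"

definition nijenhuis ::
  "(real^'n \<Rightarrow> real^'n^'n) \<Rightarrow> (real^'n \<Rightarrow> real^'n) \<Rightarrow> (real^'n \<Rightarrow> real^'n) \<Rightarrow> real^'n \<Rightarrow> real^'n" where
  "nijenhuis \<phi> X Y = (\<lambda>p.
       endo \<phi> (endo \<phi> (lie_bracket X Y)) p + lie_bracket (endo \<phi> X) (endo \<phi> Y) p
       - endo \<phi> (lie_bracket (endo \<phi> X) Y) p - endo \<phi> (lie_bracket X (endo \<phi> Y)) p)"

text \<open>
  The predicates below are meant for almost paracontact metric structures; like the notions they
  formalise, they add only the extra conditions and do not repeat the structure axioms.
\<close>

definition paracontact_metric ::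
  "(real^'n) set \<Rightarrow> (real^'n \<Rightarrow> real^'n^'n) \<Rightarrow> (real^'n \<Rightarrow> real^'n) \<Rightarrow> (real^'n \<Rightarrow> real^'n)
    \<Rightarrow> (real^'n \<Rightarrow> real^'n^'n) \<Rightarrow> bool" where
  "paracontact_metric U \<phi> \<xi> \<eta> g \<longleftrightarrow>
     (\<forall>X Y. smooth_vf U X \<longrightarrow> smooth_vf U Y \<longrightarrow>
        (\<forall>p\<in>U. fundamental_form \<phi> g X Y p = d_form1 g \<eta> X Y p))"

definition normal_structure ::
  "(real^'n) set \<Rightarrow> (real^'n \<Rightarrow> real^'n^'n) \<Rightarrow> (real^'n \<Rightarrow> real^'n) \<Rightarrow> (real^'n \<Rightarrow> real^'n)
    \<Rightarrow> (real^'n \<Rightarrow> real^'n^'n) \<Rightarrow> bool" where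
  "normal_structure U \<phi> \<xi> \<eta> g \<longleftrightarrow>
     (\<forall>X Y. smooth_vf U X \<longrightarrow> smooth_vf U Y \<longrightarrow>
        (\<forall>p\<in>U. nijenhuis \<phi> X Y p - (2 * d_form1 g \<eta> X Y p) *\<^sub>R \<xi> p = 0))"

definition para_Sasakian ::
  "(real^'n) set \<Rightarrow> (real^'n \<Rightarrow> real^'n^'n) \<Rightarrow> (real^'n \<Rightarrow> real^'n) \<Rightarrow> (real^'n \<Rightarrow> real^'n)
    \<Rightarrow> (real^'n \<Rightarrow> real^'n^'n) \<Rightarrow> bool" where
  "para_Sasakian U \<phi> \<xi> \<eta> g \<longleftrightarrow>
     normal_structure U \<phi> \<xi> \<eta> g \<and> paracontact_metric U \<phi> \<xi> \<eta> g"

text \<open>The Lie derivative of \<open>g\<close> along \<open>\<xi>\<close> vanishes.\<close>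

definition killing ::
  "(real^'n) set \<Rightarrow> (real^'n \<Rightarrow> real^'n^'n) \<Rightarrow> (real^'n \<Rightarrow> real^'n) \<Rightarrow> bool" where
  "killing U g \<xi> \<longleftrightarrow>
     (\<forall>X Y. smooth_vf U X \<longrightarrow> smooth_vf U Y \<longrightarrow>
        (\<forall>p\<in>U. dir_deriv \<xi> (form2 g X Y) p
          - form2 g (lie_bracket \<xi> X) Y p - form2 g X (lie_bracket \<xi> Y) p = 0))"

definition K_paracontact ::
  "(real^'n) set \<Rightarrow> (real^'n \<Rightarrow> real^'n^'n) \<Rightarrow> (real^'n \<Rightarrow> real^'n) \<Rightarrow> (real^'n \<Rightarrow> real^'n)
    \<Rightarrow> (real^'n \<Rightarrow> real^'n^'n) \<Rightarrow> bool" where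
  "K_paracontact U \<phi> \<xi> \<eta> g \<longleftrightarrow> paracontact_metric U \<phi> \<xi> \<eta> g \<and> killing U g \<xi>"


section \<open>Walker 3-manifolds\<close>

type_synonym scalar3 = "real^3 \<Rightarrow> real"

text \<open>Matrices are listed by rows; the coordinates \<open>x, y, z\<close> are the components 1, 2, 3.\<close>

definition walker_metric :: "scalar3 \<Rightarrow> real^3 \<Rightarrow> real^3^3" where
  "walker_metric f = (\<lambda>p. vector [
     vector [0, 0, 1],
     vector [0, 1, 0],
     vector [1, 0, f p]])"

definition walker_phi :: "scalar3 \<Rightarrow> scalar3 \<Rightarrow> scalar3 \<Rightarrow> scalar3 \<Rightarrow> real^3 \<Rightarrow> real^3^3" where
  "walker_phi f \<xi>1 \<xi>2 \<xi>3 = (\<lambda>p. vector [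
     vector [- \<xi>2 p, \<xi>1 p + f p * \<xi>3 p, - f p * \<xi>2 p],
     vector [\<xi>3 p, 0, - \<xi>1 p],
     vector [0, - \<xi>3 p, \<xi>2 p]])"

definition walker_xi :: "scalar3 \<Rightarrow> scalar3 \<Rightarrow> scalar3 \<Rightarrow> real^3 \<Rightarrow> real^3" where
  "walker_xi \<xi>1 \<xi>2 \<xi>3 = (\<lambda>p. vector [\<xi>1 p, \<xi>2 p, \<xi>3 p])"

definition walker_eta :: "scalar3 \<Rightarrow> scalar3 \<Rightarrow> scalar3 \<Rightarrow> scalar3 \<Rightarrow> real^3 \<Rightarrow> real^3" where
  "walker_eta f \<xi>1 \<xi>2 \<xi>3 = (\<lambda>p. vector [\<xi>3 p, \<xi>2 p, \<xi>1 p + f p * \<xi>3 p])"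

definition almost_paracontact_walker ::
  "(real^3) set \<Rightarrow> scalar3 \<Rightarrow> (real^3 \<Rightarrow> real^3^3) \<Rightarrow> (real^3 \<Rightarrow> real^3) \<Rightarrow> (real^3 \<Rightarrow> real^3)
    \<Rightarrow> (real^3 \<Rightarrow> real^3^3) \<Rightarrow> bool" where
  "almost_paracontact_walker U f \<phi> \<xi> \<eta> g \<longleftrightarrow>
     open U \<and> U \<noteq> {} \<and> smooth_on U f \<and>
     (\<exists>\<xi>1 \<xi>2 \<xi>3. smooth_on U \<xi>1 \<and> smooth_on U \<xi>2 \<and> smooth_on U \<xi>3 \<and>
        (\<forall>p\<in>U. (\<xi>2 p)\<^sup>2 + f p * (\<xi>3 p)\<^sup>2 + 2 * \<xi>1 p * \<xi>3 p = 1) \<and>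
        \<phi> = walker_phi f \<xi>1 \<xi>2 \<xi>3 \<and> \<xi> = walker_xi \<xi>1 \<xi>2 \<xi>3 \<and>
        \<eta> = walker_eta f \<xi>1 \<xi>2 \<xi>3 \<and> g = walker_metric f)"


text \<open>
  The rest of the theory shows that these data form an almost paracontact metric structure.
\<close>

lemma Ck_on_cong:
  assumes "open U"
  shows "(\<And>p. p \<in> U \<Longrightarrow> h p = h' p) \<Longrightarrow> Ck_on k U h \<Longrightarrow> Ck_on k U h'"
proof (induction k arbitrary: h h')
  case 0
  then show ?case using continuous_on_cong[of U U h h'] by simp
next
  case (Suc k)
  have d: "(h' has_derivative frechet_derivative h (at p)) (at p)" if "p \<in> U" for p
  proof -
    have "h differentiable (at p)"
      using Suc.prems(2) that assms by (simp add: differentiable_on_eq_differentiable_at)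
    then show ?thesis
      using has_derivative_transform_within_open[OF _ assms that Suc.prems(1)]
      by (simp add: frechet_derivative_works)
  qed
  then have "partial_deriv i h p = partial_deriv i h' p" if "p \<in> U" for p i
    using that frechet_derivative_at[OF d] by (simp add: partial_deriv_def)
  then have "Ck_on k U (partial_deriv i h')" for i
    using Suc.IH[of "partial_deriv i h" "partial_deriv i h'"] Suc.prems(2) by auto
  moreover have "h' differentiable_on U"
    using d assms differentiableI by (simp add: differentiable_on_eq_differentiable_at) blast
  ultimately show ?case by simp
qed

lemma Ck_on_const: "Ck_on k U (\<lambda>_. c)"
proof (induction k arbitrary: c)
  case (Suc k)
  have "partial_deriv i (\<lambda>_. c) = (\<lambda>_. 0)" for i :: 'a
    by (simp add: partial_deriv_def)
  then show ?case using Suc by simp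
qed simp

lemma Ck_on_differentiable:
  assumes "open U" "Ck_on (Suc k) U h" "p \<in> U"
  shows "h differentiable (at p)"
  using assms by (simp add: differentiable_on_eq_differentiable_at)

lemma Ck_on_Suc_D:
  assumes "open U"
  shows "Ck_on (Suc k) U h \<Longrightarrow> Ck_on k U h"
proof (induction k arbitrary: h)
  case 0
  then show ?case using differentiable_imp_continuous_on by auto
next
  case (Suc k)
  then show ?case by simp
qed

lemma Ck_on_add:
  assumes "open U"
  shows "Ck_on k U h \<Longrightarrow> Ck_on k U h' \<Longrightarrow> Ck_on k U (\<lambda>p. h p + h' p)"
proof (induction k arbitrary: h h')
  case 0
  then show ?case by (simp add: continuous_on_add)
next
  case (Suc k)
  note d = Ck_on_differentiable[OF assms Suc.prems(1)] Ck_on_differentiable[OF assms Suc.prems(2)]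
  have "partial_deriv i h p + partial_deriv i h' p = partial_deriv i (\<lambda>p. h p + h' p) p"
    if "p \<in> U" for p i
    using frechet_derivative_at[OF has_derivative_add[OF d[OF that, unfolded frechet_derivative_works]]]
    by (simp add: partial_deriv_def fun_eq_iff)
  then have "Ck_on k U (partial_deriv i (\<lambda>p. h p + h' p))" for i
    using Ck_on_cong[OF assms, where h = "\<lambda>p. partial_deriv i h p + partial_deriv i h' p"]
      Suc by auto
  moreover have "(\<lambda>p. h p + h' p) differentiable_on U"
    using Suc.prems by (simp add: differentiable_on_def differentiable_add)
  ultimately show ?case by simp
qed

lemma Ck_on_mult:
  assumes "open U"
  shows "Ck_on k U h \<Longrightarrow> Ck_on k U h' \<Longrightarrow> Ck_on k U (\<lambda>p. h p * h' p)"
proof (induction k arbitrary: h h')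
  case 0
  then show ?case by (simp add: continuous_on_mult)
next
  case (Suc k)
  note d = Ck_on_differentiable[OF assms Suc.prems(1)] Ck_on_differentiable[OF assms Suc.prems(2)]
  have e: "h p * partial_deriv i h' p + partial_deriv i h p * h' p = partial_deriv i (\<lambda>p. h p * h' p) p"
    if "p \<in> U" for p i
    using frechet_derivative_at[OF has_derivative_mult[OF d[OF that, unfolded frechet_derivative_works]]]
    by (simp add: partial_deriv_def fun_eq_iff)
  have "Ck_on k U (\<lambda>p. h p * partial_deriv i h' p + partial_deriv i h p * h' p)" for i
    using Suc Ck_on_Suc_D[OF assms Suc.prems(1)] Ck_on_Suc_D[OF assms Suc.prems(2)]
    by (intro Ck_on_add[OF assms]) auto
  then have "Ck_on k U (partial_deriv i (\<lambda>p. h p * h' p))" for i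
    by (rule Ck_on_cong[OF assms, rotated]) (rule e)
  moreover have "(\<lambda>p. h p * h' p) differentiable_on U"
    using Suc.prems by (simp add: differentiable_on_def differentiable_mult)
  ultimately show ?case by simp
qed

lemma smooth_on_const: "smooth_on U (\<lambda>_. c)"
  and smooth_on_add: "open U \<Longrightarrow> smooth_on U h \<Longrightarrow> smooth_on U h' \<Longrightarrow> smooth_on U (\<lambda>p. h p + h' p)"
  and smooth_on_mult: "open U \<Longrightarrow> smooth_on U h \<Longrightarrow> smooth_on U h' \<Longrightarrow> smooth_on U (\<lambda>p. h p * h' p)"
  unfolding smooth_on_def using Ck_on_const Ck_on_add Ck_on_mult by blast+

lemma smooth_on_minus:
  assumes "open U" "smooth_on U h"
  shows "smooth_on U (\<lambda>p. - h p)"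
  using smooth_on_mult[OF assms(1) smooth_on_const[of U "-1"] assms(2)] by simp

text \<open>
  Zero trace forces both eigenspaces of an involution of a plane to be lines.
\<close>

lemma eigenspaces_dim_one:
  fixes A :: "real^3^3" and e x :: "real^3"
  assumes sq: "\<And>v. A *v (A *v v) = v - (e \<bullet> v) *\<^sub>R x"
    and ex: "e \<bullet> x = 1" and Ax: "A *v x = 0"
    and tr: "A $ 1 $ 1 + A $ 2 $ 2 + A $ 3 $ 3 = 0"
  shows "dim {v. e \<bullet> v = 0 \<and> A *v v = v} = 1 \<and> dim {v. e \<bullet> v = 0 \<and> A *v v = - v} = 1"
proof -
  define P where "P = {v. e \<bullet> v = 0 \<and> A *v v = v}"
  define N where "N = {v. e \<bullet> v = 0 \<and> A *v v = - v}"
  have cube: "A *v (A *v (A *v v)) = A *v v" for v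
    using sq[of v] Ax by (simp add: matrix_vector_mult_diff_distrib matrix_vector_mult_scaleR)
  have eA: "e \<bullet> (A *v v) = 0" for v
  proof -
    have "(e \<bullet> (A *v v)) *\<^sub>R x = 0" using sq[of "A *v v"] cube[of v] by simp
    moreover have "x \<noteq> 0" using ex by auto
    ultimately show ?thesis by simp
  qed
  have sP: "subspace P" and sN: "subspace N"
    unfolding P_def N_def subspace_def
    by (auto simp: inner_add_right matrix_vector_right_distrib matrix_vector_mult_scaleR)
  have inP: "A *v (A *v v) + A *v v \<in> P" and inN: "A *v (A *v v) - A *v v \<in> N" for v
    by (simp_all add: P_def N_def inner_add_right inner_diff_right eA matrix_vector_right_distrib
        matrix_vector_mult_diff_distrib cube)
  have trsq: "(\<Sum>i\<in>UNIV. (A *v (A *v axis i 1)) $ i) = 2"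
    using ex unfolding sq
    by (simp add: sum_3 axis_def inner_vec_def)
  have trA: "(\<Sum>i\<in>UNIV. (A *v axis i 1) $ i) = 0"
    using tr by (simp add: sum_3 axis_def matrix_vector_mult_def)
  have "P \<noteq> {0}"
  proof
    assume "P = {0}"
    then have "A *v (A *v axis i 1) + A *v axis i 1 = 0" for i using inP by blast
    then have "(A *v (A *v axis i 1)) $ i + (A *v axis i 1) $ i = 0" for i
      by (metis vector_add_component zero_index)
    then have "(\<Sum>i\<in>UNIV. (A *v (A *v axis i 1)) $ i) + (\<Sum>i\<in>UNIV. (A *v axis i 1) $ i) = 0"
      unfolding sum.distrib[symmetric] by simp
    then show False using trsq trA by simp
  qed
  moreover have "N \<noteq> {0}"
  proof
    assume "N = {0}"
    then have "A *v (A *v axis i 1) - A *v axis i 1 = 0" for i using inN by blast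
    then have "(A *v (A *v axis i 1)) $ i = (A *v axis i 1) $ i" for i by simp
    then show False using trsq trA by simp
  qed
  moreover have "0 \<in> P" "0 \<in> N" using sP sN subspace_0 by blast+
  ultimately have nz: "dim P \<noteq> 0" "dim N \<noteq> 0" by auto
  have "P \<inter> N = {0}"
  proof -
    have "v = 0" if "v \<in> P" "v \<in> N" for v
    proof -
      have "v = - v" using that by (simp add: P_def N_def)
      then show ?thesis by (simp add: vec_eq_iff)
    qed
    then show ?thesis using \<open>0 \<in> P\<close> \<open>0 \<in> N\<close> by blast
  qed
  then have "dim {v + w |v w. v \<in> P \<and> w \<in> N} = dim P + dim N"
    using dim_sums_Int[OF sP sN] by simp
  moreover have "dim {v + w |v w. v \<in> P \<and> w \<in> N} \<le> dim {v. e \<bullet> v = 0}"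
    by (rule dim_subset) (auto simp: P_def N_def inner_add_right)
  moreover have "dim {v. e \<bullet> v = 0} = 2"
    using ex by (subst dim_hyperplane) auto
  ultimately show ?thesis using nz unfolding P_def N_def by linarith
qed

lemma walker_almost_paracontact_metric:
  assumes "almost_paracontact_walker U f \<phi> \<xi> \<eta> g"
  shows "almost_paracontact_metric U \<phi> \<xi> \<eta> g"
proof -
  obtain a b c where U: "open U" and sm: "smooth_on U f" "smooth_on U a" "smooth_on U b" "smooth_on U c"
    and rel: "\<And>p. p \<in> U \<Longrightarrow> (b p)\<^sup>2 + f p * (c p)\<^sup>2 + 2 * a p * c p = 1"
    and eqs: "\<phi> = walker_phi f a b c" "\<xi> = walker_xi a b c" "\<eta> = walker_eta f a b c"
      "g = walker_metric f"
    using assms unfolding almost_paracontact_walker_def by blast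
  note S = smooth_on_const smooth_on_add[OF U] smooth_on_mult[OF U] smooth_on_minus[OF U] sm
  note V = matrix_vector_mult_def inner_vec_def vec_eq_iff forall_3 sum_3
  have s1: "smooth_mf U \<phi>" "smooth_vf U \<xi>" "smooth_vf U \<eta>" "smooth_mf U g"
    unfolding smooth_mf_def smooth_vf_def eqs walker_phi_def walker_xi_def walker_eta_def
      walker_metric_def forall_3 vector_3
    by (intro conjI S)+
  have sym: "transpose (g p) = g p" for p
    by (simp add: eqs walker_metric_def transpose_def V)
  have inv: "invertible (g p)" for p
    by (simp add: invertible_det_nz det_3 eqs walker_metric_def)
  have ex: "\<eta> p \<bullet> \<xi> p = 1" if "p \<in> U" for p
    using rel[OF that] by (simp add: eqs walker_eta_def walker_xi_def V power2_eq_square algebra_simps)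
  have Ax: "\<phi> p *v \<xi> p = 0" for p
    by (simp add: eqs walker_phi_def walker_xi_def V algebra_simps)
  have k: "y * b p * b p + y * f p * c p * c p + 2 * y * a p * c p = y" if "p \<in> U" for p y
    using arg_cong[OF rel[OF that], of "\<lambda>r. y * r"] by (simp add: power2_eq_square algebra_simps)
  have sq: "\<phi> p *v (\<phi> p *v v) = v - (\<eta> p \<bullet> v) *\<^sub>R \<xi> p" if "p \<in> U" for p v
    using k[OF that, of "v $ 1"] k[OF that, of "v $ 2"] k[OF that, of "v $ 3"]
    by (simp add: eqs walker_phi_def walker_eta_def walker_xi_def V algebra_simps)
  have met: "(\<phi> p *v v) \<bullet> (g p *v (\<phi> p *v w)) = - (v \<bullet> (g p *v w)) + (\<eta> p \<bullet> v) * (\<eta> p \<bullet> w)"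
    if "p \<in> U" for p v w
    using k[OF that, of "v $ 1 * w $ 3"] k[OF that, of "v $ 2 * w $ 2"]
      k[OF that, of "v $ 3 * w $ 1"] k[OF that, of "f p * v $ 3 * w $ 3"]
    by (simp add: eqs walker_phi_def walker_eta_def walker_metric_def V algebra_simps)
  have "\<phi> p $ 1 $ 1 + \<phi> p $ 2 $ 2 + \<phi> p $ 3 $ 3 = 0" for p
    by (simp add: eqs walker_phi_def)
  from eigenspaces_dim_one[OF sq ex Ax this]
  have "\<exists>n. CARD(3) = 2 * n + 1 \<and> dim {v. \<eta> p \<bullet> v = 0 \<and> \<phi> p *v v = v} = n \<and>
      dim {v. \<eta> p \<bullet> v = 0 \<and> \<phi> p *v v = - v} = n" if "p \<in> U" for p
    using that by (intro exI[of _ 1]) simp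
  then show ?thesis
    unfolding almost_paracontact_metric_def pseudo_riemannian_def
    using s1 sym inv ex Ax sq met by blast
qed

end

theory Submission
  imports Defs
begin

text \<open>
  Write \<open>\<xi> = (a, b, c)\<close>. The condition \<open>\<phi> = d\<eta>\<close> and \<open>d d\<eta> = 0\<close> give \<open>div \<xi> = 0\<close>. Where \<open>c \<noteq> 0\<close>,
  normality (read off from \<open>N(\<partial>\<^sub>x, \<partial>\<^sub>y)\<close>) or the Killing equation forces \<open>\<partial>\<^sub>y b = 0\<close>,
  \<open>\<partial>\<^sub>x b = c\<close> and \<open>\<partial>\<^sub>y c = -c\<close>; symmetry of the mixed partials of \<open>b\<close> then gives \<open>\<partial>\<^sub>y c = 0\<close>, hence \<open>c = 0\<close>.
  So \<open>c\<close> vanishes identically, \<open>b\<^sup>2 = 1\<close>, and \<open>div \<xi> = 0\<close> reduces to \<open>\<partial>\<^sub>x a = 0\<close>, whereas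
  \<open>\<phi> = d\<eta>\<close> requires \<open>\<partial>\<^sub>x a = -2 b\<close>.
\<close>

section \<open>Symmetry of mixed partial derivatives\<close>

lemma has_real_derivative_along_axis:
  fixes h :: "real^'n \<Rightarrow> real"
  assumes "h differentiable (at (q + s *\<^sub>R axis i 1))"
  shows "((\<lambda>s. h (q + s *\<^sub>R axis i 1)) has_real_derivative
           partial_deriv i h (q + s *\<^sub>R axis i 1)) (at s)"
proof -
  let ?D = "frechet_derivative h (at (q + s *\<^sub>R axis i 1))"
  have D: "(h has_derivative ?D) (at (q + s *\<^sub>R axis i 1))"
    using assms by (simp add: frechet_derivative_works)
  have "((\<lambda>s. q + s *\<^sub>R axis i 1) has_derivative (\<lambda>x. x *\<^sub>R axis i 1)) (at s)"
    by (auto intro!: derivative_eq_intros)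
  from has_derivative_compose[OF this D]
  have "((\<lambda>s. h (q + s *\<^sub>R axis i 1)) has_derivative (\<lambda>x. ?D (x *\<^sub>R axis i 1))) (at s)" .
  moreover have "(\<lambda>x. ?D (x *\<^sub>R axis i 1)) = (*) (partial_deriv i h (q + s *\<^sub>R axis i 1))"
    using linear_cmul[OF linear_frechet_derivative[OF assms]]
    by (simp add: partial_deriv_def fun_eq_iff)
  ultimately show ?thesis by (simp add: has_field_derivative_def)
qed

text \<open>The second difference is the increment over [0, t] in direction \<open>i\<close> of the
  difference of \<open>h\<close> across a step \<open>t\<close> in direction \<open>j\<close>. The
  mean value theorem in direction \<open>i\<close>, then for \<open>partial_deriv i h\<close> in
  direction \<open>j\<close>, yields the intermediate point.\<close>

lemma second_difference_mean_value:
  fixes h :: "real^'n \<Rightarrow> real"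
  assumes "open U" "Ck_on (Suc (Suc 0)) U h" "0 < t"
    and box: "\<And>s r. 0 \<le> s \<Longrightarrow> s \<le> t \<Longrightarrow> 0 \<le> r \<Longrightarrow> r \<le> t \<Longrightarrow>
                p + s *\<^sub>R axis i 1 + r *\<^sub>R axis j 1 \<in> U"
  obtains s r where "0 < s" "s < t" "0 < r" "r < t"
    "h (p + t *\<^sub>R axis i 1 + t *\<^sub>R axis j 1) - h (p + t *\<^sub>R axis i 1) - h (p + t *\<^sub>R axis j 1) + h p
     = t * t * partial_deriv j (partial_deriv i h) (p + s *\<^sub>R axis i 1 + r *\<^sub>R axis j 1)"
proof -
  have d: "h differentiable (at q)" "partial_deriv i h differentiable (at q)" if "q \<in> U" for q
    using assms(1,2) that by (simp_all add: differentiable_on_eq_differentiable_at)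
  define u where "u s = h ((p + t *\<^sub>R axis j 1) + s *\<^sub>R axis i 1) - h (p + s *\<^sub>R axis i 1)" for s
  have "(u has_real_derivative (partial_deriv i h ((p + t *\<^sub>R axis j 1) + s *\<^sub>R axis i 1)
      - partial_deriv i h (p + s *\<^sub>R axis i 1))) (at s)" if "0 \<le> s" "s \<le> t" for s
    unfolding u_def using box[OF that, of t] box[OF that, of 0] assms(3)
    by (intro DERIV_diff has_real_derivative_along_axis d) (simp_all add: algebra_simps)
  from MVT2[OF assms(3) this] obtain s where s: "0 < s" "s < t"
    and us: "u t - u 0 = t * (partial_deriv i h ((p + t *\<^sub>R axis j 1) + s *\<^sub>R axis i 1)
      - partial_deriv i h (p + s *\<^sub>R axis i 1))" by auto
  have "((\<lambda>r. partial_deriv i h ((p + s *\<^sub>R axis i 1) + r *\<^sub>R axis j 1)) has_real_derivative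
      partial_deriv j (partial_deriv i h) ((p + s *\<^sub>R axis i 1) + r *\<^sub>R axis j 1)) (at r)"
    if "0 \<le> r" "r \<le> t" for r
    using box[of s r] s that by (intro has_real_derivative_along_axis d) simp
  from MVT2[OF assms(3) this] obtain r where r: "0 < r" "r < t"
    and vr: "partial_deriv i h ((p + s *\<^sub>R axis i 1) + t *\<^sub>R axis j 1) - partial_deriv i h (p + s *\<^sub>R axis i 1)
      = t * partial_deriv j (partial_deriv i h) ((p + s *\<^sub>R axis i 1) + r *\<^sub>R axis j 1)" by auto
  show ?thesis
    using that[OF s r] us vr by (simp add: u_def algebra_simps)
qed

text \<open>The second difference is unchanged when \<open>i\<close> and \<open>j\<close> are
  swapped, so the two mixed partials take a common value at two points arbitrarily close to
  \<open>p\<close>. Continuity at \<open>p\<close> then excludes a gap of size 2 * \<open>e\<close>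
  between them.\<close>

lemma partial_deriv_commute:
  fixes h :: "real^'n \<Rightarrow> real"
  assumes "open U" "smooth_on U h" "p \<in> U"
  shows "partial_deriv i (partial_deriv j h) p = partial_deriv j (partial_deriv i h) p"
proof (rule ccontr)
  define F where "F = partial_deriv j (partial_deriv i h)"
  define G where "G = partial_deriv i (partial_deriv j h)"
  define e where "e = \<bar>F p - G p\<bar> / 2"
  assume "partial_deriv i (partial_deriv j h) p \<noteq> partial_deriv j (partial_deriv i h) p"
  then have e: "e > 0" by (simp add: e_def F_def G_def)
  have C2: "Ck_on (Suc (Suc 0)) U h" using assms(2) unfolding smooth_on_def by blast
  then have "continuous_on U F" "continuous_on U G"
    by (simp_all add: F_def G_def)
  then have "isCont F p" "isCont G p"
    using assms(1,3) continuous_on_eq_continuous_at by blast+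
  then obtain d1 d2 where "d1 > 0" "d2 > 0"
    and near: "\<And>q. dist q p < d1 \<Longrightarrow> \<bar>F q - F p\<bar> < e" "\<And>q. dist q p < d2 \<Longrightarrow> \<bar>G q - G p\<bar> < e"
    using e unfolding continuous_at_eps_delta dist_real_def by metis
  moreover obtain d0 where "d0 > 0" and ball: "ball p d0 \<subseteq> U"
    using assms(1,3) openE by blast
  ultimately obtain d where d: "d > 0" "d \<le> d0" "d \<le> d1" "d \<le> d2"
    by (metis linorder_not_le nle_le order_less_le_trans)
  \<comment> \<open>Two axis steps of length at most \<open>t\<close> move a point by at most 2 *
    \<open>t\<close> < \<open>d\<close>, so the whole square stays in \<open>U\<close> and where
    \<open>F\<close> and \<open>G\<close> vary by less than \<open>e\<close>.\<close>
  define t where "t = d / 3"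
  have t: "0 < t" using d by (simp add: t_def)
  have close: "dist (p + s *\<^sub>R axis k 1 + r *\<^sub>R axis l 1) p < d"
    if "0 \<le> s" "s \<le> t" "0 \<le> r" "r \<le> t" for s r k l
  proof -
    have "dist (p + s *\<^sub>R axis k 1 + r *\<^sub>R axis l 1) p = norm (s *\<^sub>R (axis k 1 :: real^'n) + r *\<^sub>R axis l 1)"
      by (simp add: dist_norm add.assoc)
    also have "\<dots> \<le> norm (s *\<^sub>R (axis k 1 :: real^'n)) + norm (r *\<^sub>R (axis l 1 :: real^'n))"
      by (rule norm_triangle_ineq)
    also have "\<dots> \<le> t + t" using that by simp
    also have "\<dots> < d" using d by (simp add: t_def)
    finally show ?thesis .
  qed
  have box: "p + s *\<^sub>R axis k 1 + r *\<^sub>R axis l 1 \<in> U"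
    if "0 \<le> s" "s \<le> t" "0 \<le> r" "r \<le> t" for s r k l
    using less_le_trans[OF close[OF that, of k l] d(2)] ball by (auto simp: dist_commute subset_iff)
  obtain s r where 1: "0 < s" "s < t" "0 < r" "r < t"
    "h (p + t *\<^sub>R axis i 1 + t *\<^sub>R axis j 1) - h (p + t *\<^sub>R axis i 1) - h (p + t *\<^sub>R axis j 1) + h p
     = t * t * F (p + s *\<^sub>R axis i 1 + r *\<^sub>R axis j 1)"
    unfolding F_def using second_difference_mean_value[OF assms(1) C2 t box] .
  obtain s' r' where 2: "0 < s'" "s' < t" "0 < r'" "r' < t"
    "h (p + t *\<^sub>R axis j 1 + t *\<^sub>R axis i 1) - h (p + t *\<^sub>R axis j 1) - h (p + t *\<^sub>R axis i 1) + h p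
     = t * t * G (p + s' *\<^sub>R axis j 1 + r' *\<^sub>R axis i 1)"
    unfolding G_def using second_difference_mean_value[OF assms(1) C2 t box] .
  have "t * t * F (p + s *\<^sub>R axis i 1 + r *\<^sub>R axis j 1) = t * t * G (p + s' *\<^sub>R axis j 1 + r' *\<^sub>R axis i 1)"
    using 1(5) 2(5) unfolding add.assoc[of p "t *\<^sub>R axis i 1"] add.assoc[of p "t *\<^sub>R axis j 1"]
      add.commute[of "t *\<^sub>R axis j 1" "t *\<^sub>R axis i 1"] by linarith
  then have "F (p + s *\<^sub>R axis i 1 + r *\<^sub>R axis j 1) = G (p + s' *\<^sub>R axis j 1 + r' *\<^sub>R axis i 1)"
    using t by simp
  moreover have "\<bar>F (p + s *\<^sub>R axis i 1 + r *\<^sub>R axis j 1) - F p\<bar> < e"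
    using close[of s r i j] 1 d by (intro near) auto
  moreover have "\<bar>G (p + s' *\<^sub>R axis j 1 + r' *\<^sub>R axis i 1) - G p\<bar> < e"
    using close[of s' r' j i] 2 d by (intro near) auto
  ultimately have "\<bar>F p - G p\<bar> < 2 * e" by linarith
  then show False by (simp add: e_def)
qed

section \<open>Rules for partial derivatives and the coordinate form of
  \<open>d_form1\<close>\<close>

text \<open>Allows differentiating identities known only on an open set.\<close>

lemma partial_deriv_cong:
  assumes "open U" "p \<in> U" "h differentiable (at p)" "\<And>q. q \<in> U \<Longrightarrow> h q = h' q"
  shows "partial_deriv i h p = partial_deriv i h' p"
  unfolding partial_deriv_def
  using frechet_derivative_transform_within_open[OF assms(3,1,2,4)] by simp

lemma partial_deriv_const: "partial_deriv i (\<lambda>_. k) p = 0"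
  by (simp add: partial_deriv_def)

lemma partial_deriv_add:
  assumes "h differentiable (at p)" "h' differentiable (at p)"
  shows "partial_deriv i (\<lambda>q. h q + h' q) p = partial_deriv i h p + partial_deriv i h' p"
  using frechet_derivative_at[OF has_derivative_add[OF assms[unfolded frechet_derivative_works]]]
  by (simp add: partial_deriv_def fun_eq_iff)

lemma partial_deriv_diff:
  assumes "h differentiable (at p)" "h' differentiable (at p)"
  shows "partial_deriv i (\<lambda>q. h q - h' q) p = partial_deriv i h p - partial_deriv i h' p"
  using frechet_derivative_at[OF has_derivative_diff[OF assms[unfolded frechet_derivative_works]]]
  by (simp add: partial_deriv_def fun_eq_iff)

lemma partial_deriv_mult:
  assumes "h differentiable (at p)" "h' differentiable (at p)"
  shows "partial_deriv i (\<lambda>q. h q * h' q) p = h p * partial_deriv i h' p + partial_deriv i h p * h' p"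
  using frechet_derivative_at[OF has_derivative_mult[OF assms[unfolded frechet_derivative_works]]]
  by (simp add: partial_deriv_def fun_eq_iff)

lemma partial_deriv_minus:
  assumes "h differentiable (at p)"
  shows "partial_deriv i (\<lambda>q. - h q) p = - partial_deriv i h p"
  using frechet_derivative_at[OF has_derivative_minus[OF assms[unfolded frechet_derivative_works]]]
  by (simp add: partial_deriv_def fun_eq_iff)

lemma smooth_on_partial_deriv:
  assumes "smooth_on U h"
  shows "smooth_on U (partial_deriv i h)"
  unfolding smooth_on_def
proof
  fix k
  have "Ck_on (Suc k) U h" using assms unfolding smooth_on_def by blast
  then show "Ck_on k U (partial_deriv i h)" by simp
qed

lemma smooth_vf_const: "smooth_vf U (\<lambda>_. v)"
  by (simp add: smooth_vf_def smooth_on_const)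

lemma dir_deriv_axis: "dir_deriv (\<lambda>_. axis i 1) h = partial_deriv i h"
  by (simp add: dir_deriv_def partial_deriv_def)

text \<open>Coordinate fields commute, so vanishing torsion makes the two connection terms cancel;
  no Christoffel symbol has to be computed.\<close>

lemma d_form1_axis:
  fixes g :: "real^'n \<Rightarrow> real^'n^'n"
  assumes "open U" "pseudo_riemannian U g" "p \<in> U"
  shows "d_form1 g \<eta> (\<lambda>_. axis i 1) (\<lambda>_. axis j 1) p
    = 1/2 * (partial_deriv i (\<lambda>q. \<eta> q $ j) p - partial_deriv j (\<lambda>q. \<eta> q $ i) p)"
proof -
  let ?i = "\<lambda>_. axis i 1 :: real^'n" and ?j = "\<lambda>_. axis j 1 :: real^'n"
  have "lie_bracket ?i ?j p = 0"
    by (simp add: lie_bracket_def vec_eq_iff dir_deriv_axis partial_deriv_const)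
  then have "levi_civita g ?i ?j p = levi_civita g ?j ?i p"
    using levi_civita_torsion_free[OF assms, of ?i ?j] by simp
  moreover have "form1 \<eta> ?i = (\<lambda>q. \<eta> q $ i)" "form1 \<eta> ?j = (\<lambda>q. \<eta> q $ j)"
    by (simp_all add: form1_def inner_axis)
  ultimately show ?thesis
    by (simp add: d_form1_def nabla_form1_def dir_deriv_axis form1_def)
qed

text \<open>
  Here \<open>m\<close> stands for \<open>\<xi>\<^sub>1 + f \<xi>\<^sub>3\<close>, the \<open>dz\<close>-coefficient of \<open>\<eta>\<close>; the partial differential
  equations express \<open>\<phi> = d\<eta>\<close>.
\<close>

locale paracontact_walker =
  fixes U :: "(real^3) set" and f a b c m :: "real^3 \<Rightarrow> real"
  assumes open_U: "open U"
    and smooth: "smooth_on U f" "smooth_on U a" "smooth_on U b" "smooth_on U c"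
    and m_def: "m = (\<lambda>p. a p + f p * c p)"
    and unit: "p \<in> U \<Longrightarrow> b p * b p + c p * (a p + m p) = 1"
    and dxy: "p \<in> U \<Longrightarrow> partial_deriv 1 b p - partial_deriv 2 c p = 2 * c p"
    and dxz: "p \<in> U \<Longrightarrow> partial_deriv 1 m p - partial_deriv 3 c p = - 2 * b p"
    and dyz: "p \<in> U \<Longrightarrow> partial_deriv 2 m p - partial_deriv 3 b p = 2 * a p"
begin

section \<open>Differential consequences of \<open>\<phi> = d\<eta>\<close>\<close>

lemma smooth_m: "smooth_on U m"
  unfolding m_def by (intro smooth_on_add smooth_on_mult open_U smooth)

lemma differentiable:
  assumes "p \<in> U"
  shows "f differentiable (at p)" "a differentiable (at p)" "b differentiable (at p)"
    "c differentiable (at p)" "m differentiable (at p)"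
    "partial_deriv i a differentiable (at p)" "partial_deriv i b differentiable (at p)"
    "partial_deriv i c differentiable (at p)" "partial_deriv i m differentiable (at p)"
  using smooth smooth_m smooth_on_partial_deriv smooth_on_differentiable[OF open_U _ assms] by blast+

text \<open>This is the closedness of \<open>d\<eta>\<close>: differentiate \<open>dxy\<close> by z,
  \<open>dxz\<close> by y and \<open>dyz\<close> by x. In the alternating sum the mixed partials
  cancel, leaving twice the divergence.\<close>

lemma divergence_free:
  assumes "p \<in> U"
  shows "partial_deriv 1 a p + partial_deriv 2 b p + partial_deriv 3 c p = 0"
proof -
  note D = differentiable[OF assms]
  have 1: "partial_deriv 3 (partial_deriv 1 b) p - partial_deriv 3 (partial_deriv 2 c) p
      = 2 * partial_deriv 3 c p"
    using partial_deriv_cong[OF open_U assms,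
        of "\<lambda>q. partial_deriv 1 b q - partial_deriv 2 c q" "\<lambda>q. 2 * c q" 3] dxy D
    by (simp add: partial_deriv_diff partial_deriv_mult partial_deriv_const)
  have 2: "partial_deriv 2 (partial_deriv 1 m) p - partial_deriv 2 (partial_deriv 3 c) p
      = - 2 * partial_deriv 2 b p"
    using partial_deriv_cong[OF open_U assms,
        of "\<lambda>q. partial_deriv 1 m q - partial_deriv 3 c q" "\<lambda>q. - 2 * b q" 2] dxz D
    by (simp add: partial_deriv_diff partial_deriv_mult partial_deriv_minus partial_deriv_const)
  have 3: "partial_deriv 1 (partial_deriv 2 m) p - partial_deriv 1 (partial_deriv 3 b) p
      = 2 * partial_deriv 1 a p"
    using partial_deriv_cong[OF open_U assms,
        of "\<lambda>q. partial_deriv 2 m q - partial_deriv 3 b q" "\<lambda>q. 2 * a q" 1] dyz D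
    by (simp add: partial_deriv_diff partial_deriv_mult partial_deriv_const)
  show ?thesis
    using 1 2 3 partial_deriv_commute[OF open_U smooth(3) assms, of 1 3]
      partial_deriv_commute[OF open_U smooth(4) assms, of 2 3]
      partial_deriv_commute[OF open_U smooth_m assms, of 1 2] by linarith
qed

lemma unit_dx:
  assumes "p \<in> U"
  shows "2 * b p * partial_deriv 1 b p + partial_deriv 1 c p * (a p + m p)
    + c p * (partial_deriv 1 a p + partial_deriv 1 m p) = 0"
proof -
  have "partial_deriv 1 (\<lambda>q. b q * b q + c q * (a q + m q)) p = 0"
    using partial_deriv_cong[OF open_U assms,
        of "\<lambda>q. b q * b q + c q * (a q + m q)" "\<lambda>q. 1" 1] unit differentiable[OF assms]
    by (simp add: partial_deriv_const)
  then show ?thesis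
    using differentiable[OF assms]
    by (simp add: partial_deriv_add partial_deriv_mult)
qed

text \<open>Common end of the Killing and the normal case. The two equations are asked only where
  \<open>c\<close> is nonzero because the normal case obtains them by cancelling
  \<open>c\<close>.\<close>

lemma contradiction:
  assumes "U \<noteq> {}"
    and b_y: "\<And>p. p \<in> U \<Longrightarrow> c p \<noteq> 0 \<Longrightarrow> partial_deriv 2 b p = 0"
    and b_x: "\<And>p. p \<in> U \<Longrightarrow> c p \<noteq> 0 \<Longrightarrow> partial_deriv 1 b p = c p"
  shows False
proof -
  have c0: "c p = 0" if p: "p \<in> U" for p
  proof (rule ccontr)
    assume "c p \<noteq> 0"
    \<comment> \<open>The equations for \<open>b\<close> hold on this open set, so they may be
      differentiated at \<open>p\<close>.\<close>
    define V where "V = {q \<in> U. c q \<noteq> 0}"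
    have "continuous_on U c"
      using smooth(4) unfolding smooth_on_def by (metis Ck_on.simps(1))
    then have "open V"
      using continuous_open_preimage[OF _ open_U, of c "- {0}"]
      by (simp add: V_def vimage_def Int_def open_Compl)
    moreover have "p \<in> V" using p \<open>c p \<noteq> 0\<close> by (simp add: V_def)
    ultimately have "partial_deriv 2 (partial_deriv 1 b) p = partial_deriv 2 c p"
      and "partial_deriv 1 (partial_deriv 2 b) p = 0"
      using partial_deriv_cong[of V p "partial_deriv 1 b" c 2]
        partial_deriv_cong[of V p "partial_deriv 2 b" "\<lambda>_. 0" 1] b_y b_x differentiable[OF p]
      by (auto simp: V_def partial_deriv_const)
    then have "partial_deriv 2 c p = 0"
      using partial_deriv_commute[OF open_U smooth(3) p, of 1 2] by simp
    \<comment> \<open>With \<open>partial_deriv 1 b p = c p\<close> and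
      \<open>partial_deriv 2 c p = 0\<close>, \<open>dxy\<close> reads
      \<open>c p = 2 * c p\<close>.\<close>
    then show False using dxy[OF p] b_x[OF p] \<open>c p \<noteq> 0\<close> by simp
  qed
  obtain p where p: "p \<in> U" using assms(1) by blast
  note D = differentiable[OF p]
  have bb: "b q * b q = 1" if "q \<in> U" for q using unit[OF that] c0[OF that] by simp
  have "partial_deriv 2 (\<lambda>q. b q * b q) p = 0"
    using partial_deriv_cong[OF open_U p, of "\<lambda>q. b q * b q" "\<lambda>_. 1" 2] bb D by (simp add: partial_deriv_const)
  then have "b p * partial_deriv 2 b p = 0" using D by (simp add: partial_deriv_mult)
  then have "partial_deriv 2 b p = 0" using bb[OF p] by auto
  moreover have cz: "partial_deriv 3 c p = 0"
    using partial_deriv_cong[OF open_U p, of c "\<lambda>_. 0" 3] c0 D by (simp add: partial_deriv_const)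
  ultimately have "partial_deriv 1 a p = 0" using divergence_free[OF p] by simp
  moreover have "partial_deriv 1 m p = partial_deriv 1 a p"
    using partial_deriv_cong[OF open_U p, of m a 1] D c0 by (simp add: m_def)
  \<comment> \<open>Now \<open>dxz\<close> reduces to \<open>b p = 0\<close>, against
    \<open>b p * b p = 1\<close>.\<close>
  ultimately show False using dxz[OF p] cz bb[OF p] by simp
qed

end

section \<open>Reading the differential equations off the structure\<close>

text \<open>The three equations are \<open>\<phi> = d\<eta>\<close> on the pairs of coordinate
  fields (1,2), (1,3) and (2,3); the factor 2 on their right sides comes from the 1/2 in
  \<open>d_form1\<close>.\<close>

lemma paracontact_walkerI:
  fixes f a b c :: "real^3 \<Rightarrow> real"
  assumes "open U" "smooth_on U f" "smooth_on U a" "smooth_on U b" "smooth_on U c"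
    and rel: "\<And>p. p \<in> U \<Longrightarrow> (b p)\<^sup>2 + f p * (c p)\<^sup>2 + 2 * a p * c p = 1"
    and pr: "pseudo_riemannian U (walker_metric f)"
    and pm: "paracontact_metric U (walker_phi f a b c) (walker_xi a b c) (walker_eta f a b c)
      (walker_metric f)"
  shows "paracontact_walker U f a b c (\<lambda>p. a p + f p * c p)"
proof
  have eq: "fundamental_form (walker_phi f a b c) (walker_metric f) (\<lambda>_. axis i 1) (\<lambda>_. axis j 1) p
      = 1/2 * (partial_deriv i (\<lambda>q. walker_eta f a b c q $ j) p
        - partial_deriv j (\<lambda>q. walker_eta f a b c q $ i) p)" if "p \<in> U" for p i j
    unfolding d_form1_axis[OF assms(1) pr that, symmetric]
    using pm that smooth_vf_const[of U] unfolding paracontact_metric_def by blast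
  note S = fundamental_form_def form2_def endo_def walker_phi_def walker_metric_def walker_eta_def
    matrix_vector_mult_def inner_vec_def sum_3 axis_def
  show "partial_deriv 1 b p - partial_deriv 2 c p = 2 * c p" if "p \<in> U" for p
    using eq[OF that, of 1 2] by (simp add: S)
  show "partial_deriv 1 (\<lambda>p. a p + f p * c p) p - partial_deriv 3 c p = - 2 * b p" if "p \<in> U" for p
    using eq[OF that, of 1 3] by (simp add: S)
  show "partial_deriv 2 (\<lambda>p. a p + f p * c p) p - partial_deriv 3 b p = 2 * a p" if "p \<in> U" for p
    using eq[OF that, of 2 3] by (simp add: S)
  show "b p * b p + c p * (a p + (a p + f p * c p)) = 1" if "p \<in> U" for p
    using rel[OF that] by (simp add: power2_eq_square algebra_simps)
qed (use assms in auto)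

section \<open>Excluding the Killing and the normality condition\<close>

context paracontact_walker
begin

text \<open>The metric coefficients with indices (2,2) and (1,2) are constant, so these components
  of the Killing equation involve only derivatives of \<open>b\<close> and \<open>c\<close>. Adding
  \<open>dxy\<close> to the (1,2) component gives \<open>partial_deriv 1 b = c\<close>.\<close>

lemma not_killing:
  assumes "U \<noteq> {}"
  shows "\<not> killing U (walker_metric f) (walker_xi a b c)"
proof
  assume k: "killing U (walker_metric f) (walker_xi a b c)"
  let ?e = "\<lambda>i _. axis i 1 :: real^3"
  have eq: "dir_deriv (walker_xi a b c) (form2 (walker_metric f) (?e i) (?e j)) p
      - form2 (walker_metric f) (lie_bracket (walker_xi a b c) (?e i)) (?e j) p
      - form2 (walker_metric f) (?e i) (lie_bracket (walker_xi a b c) (?e j)) p = 0"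
    if "p \<in> U" for p i j
    using k that smooth_vf_const unfolding killing_def by blast
  note S = form2_def lie_bracket_def dir_deriv_axis walker_metric_def walker_xi_def dir_deriv_def
    matrix_vector_mult_def inner_vec_def sum_3 axis_def partial_deriv_def
  have "partial_deriv 2 b p = 0" if "p \<in> U" for p
    using eq[OF that, of 2 2] by (simp add: S)
  moreover have "partial_deriv 1 b p + partial_deriv 2 c p = 0" if "p \<in> U" for p
    using eq[OF that, of 1 2] by (simp add: S)
  ultimately show False
    using contradiction[OF assms] dxy by force
qed

text \<open>The second and third components of N on the first two coordinate fields suffice.
  Together with the derivative of the unit condition they form a system that is linear in the first
  derivatives and forces \<open>partial_deriv 1 c = 0\<close> wherever \<open>c\<close> is
  nonzero.\<close>

lemma not_normal:
  assumes "U \<noteq> {}" and pr: "pseudo_riemannian U (walker_metric f)"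
  shows "\<not> normal_structure U (walker_phi f a b c) (walker_xi a b c) (walker_eta f a b c)
    (walker_metric f)"
proof
  assume n: "normal_structure U (walker_phi f a b c) (walker_xi a b c) (walker_eta f a b c)
    (walker_metric f)"
  let ?e = "\<lambda>i _. axis i 1 :: real^3"
  have phi1: "endo (walker_phi f a b c) (?e 1) = (\<lambda>p. vector [- b p, c p, 0])"
    by (simp add: endo_def walker_phi_def matrix_vector_mult_def axis_def sum_3 vec_eq_iff forall_3 fun_eq_iff)
  have phi2: "endo (walker_phi f a b c) (?e 2) = (\<lambda>p. vector [m p, 0, - c p])"
    by (simp add: endo_def walker_phi_def matrix_vector_mult_def axis_def sum_3 vec_eq_iff forall_3 m_def fun_eq_iff)
  have *: "partial_deriv 2 b p = 0 \<and> partial_deriv 1 b p = c p" if p: "p \<in> U" and "c p \<noteq> 0" for p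
  proof -
    note D = differentiable[OF p]
    have br: "lie_bracket (?e 1) (?e 2) p = 0"
      by (simp add: lie_bracket_def vec_eq_iff dir_deriv_axis partial_deriv_const)
    have br1: "lie_bracket (endo (walker_phi f a b c) (?e 1)) (?e 2) p
        = vector [partial_deriv 2 b p, - partial_deriv 2 c p, 0]"
      using D by (simp add: lie_bracket_def phi1 vec_eq_iff forall_3 dir_deriv_axis partial_deriv_minus
          partial_deriv_const dir_deriv_partial)
    have br2: "lie_bracket (?e 1) (endo (walker_phi f a b c) (?e 2)) p
        = vector [partial_deriv 1 m p, 0, - partial_deriv 1 c p]"
      using D by (simp add: lie_bracket_def phi2 vec_eq_iff forall_3 dir_deriv_axis partial_deriv_minus
          partial_deriv_const dir_deriv_partial)
    have br12: "lie_bracket (endo (walker_phi f a b c) (?e 1)) (endo (walker_phi f a b c) (?e 2)) p $ 2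
        = - m p * partial_deriv 1 c p + c p * partial_deriv 3 c p"
      "lie_bracket (endo (walker_phi f a b c) (?e 1)) (endo (walker_phi f a b c) (?e 2)) p $ 3
        = b p * partial_deriv 1 c p - c p * partial_deriv 2 c p"
      using D by (simp_all add: lie_bracket_def phi1 phi2 partial_deriv_minus
          partial_deriv_const dir_deriv_partial sum_3)
    have "d_form1 (walker_metric f) (walker_eta f a b c) (?e 1) (?e 2) p = c p"
      using dxy[OF p] by (simp add: d_form1_axis[OF open_U pr p] walker_eta_def)
    then have N: "nijenhuis (walker_phi f a b c) (?e 1) (?e 2) p = (2 * c p) *\<^sub>R vector [a p, b p, c p]"
      using n p smooth_vf_const[of U] unfolding normal_structure_def walker_xi_def by fastforce
    have "endo (walker_phi f a b c) (endo (walker_phi f a b c) (lie_bracket (?e 1) (?e 2))) p = 0"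
      by (simp add: endo_def br)
    then have expand: "nijenhuis (walker_phi f a b c) (?e 1) (?e 2) p
      = lie_bracket (endo (walker_phi f a b c) (?e 1)) (endo (walker_phi f a b c) (?e 2)) p
        - walker_phi f a b c p *v vector [partial_deriv 2 b p, - partial_deriv 2 c p, 0]
        - walker_phi f a b c p *v vector [partial_deriv 1 m p, 0, - partial_deriv 1 c p]"
      unfolding br1[symmetric] br2[symmetric]
      by (simp add: nijenhuis_def endo_def[of _ "lie_bracket _ _"])
    have N3: "b p * partial_deriv 1 c p = c p * (partial_deriv 2 c p + c p)"
      using arg_cong[OF N, of "\<lambda>v. v $ 3"]
      by (simp add: expand br12) (simp add: walker_phi_def matrix_vector_mult_def sum_3 algebra_simps)
    have N2: "- m p * partial_deriv 1 c p + c p * partial_deriv 3 c p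
        - c p * (partial_deriv 2 b p + partial_deriv 1 m p) - a p * partial_deriv 1 c p = 2 * c p * b p"
      using arg_cong[OF N, of "\<lambda>v. v $ 2"]
      by (simp add: expand br12) (simp add: walker_phi_def matrix_vector_mult_def sum_3 algebra_simps)
    have mx: "partial_deriv 1 m p = partial_deriv 3 c p - 2 * b p"
      using dxz[OF p] by simp
    have bx: "partial_deriv 1 b p = partial_deriv 2 c p + 2 * c p"
      using dxy[OF p] by simp
    have ax: "partial_deriv 1 a p = - partial_deriv 2 b p - partial_deriv 3 c p"
      using divergence_free[OF p] by simp
    have c_b_y: "c p * partial_deriv 2 b p = - (a p + m p) * partial_deriv 1 c p"
      using N2 unfolding mx by (simp add: algebra_simps)
    \<comment> \<open>In \<open>unit_dx\<close> all x-derivatives except that of \<open>c\<close>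
      are eliminated, then \<open>c_b_y\<close> removes \<open>partial_deriv 2 b p\<close>; what
      remains is twice this equation.\<close>
    have "b p * (partial_deriv 2 c p + c p) + (a p + m p) * partial_deriv 1 c p = 0"
      using unit_dx[OF p] c_b_y unfolding mx bx ax by (simp add: algebra_simps)
    \<comment> \<open>After multiplication by \<open>c p\<close>, \<open>N3\<close> applies to the
      first summand, and the coefficient of \<open>partial_deriv 1 c p\<close> becomes the left side
      of \<open>unit\<close>, which is 1.\<close>
    then have "b p * (c p * (partial_deriv 2 c p + c p)) + c p * (a p + m p) * partial_deriv 1 c p = 0"
      by algebra
    then have "(b p * b p + c p * (a p + m p)) * partial_deriv 1 c p = 0"
      unfolding N3[symmetric] by (simp add: algebra_simps)
    then have "partial_deriv 1 c p = 0"
      using unit[OF p] by simp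
    then show ?thesis
      using N3 c_b_y bx \<open>c p \<noteq> 0\<close> by simp
  qed
  show False using contradiction[OF assms(1)] * by blast
qed

end

theorem theorem4p1:
  fixes U :: "(real^3) set" and f :: "real^3 \<Rightarrow> real"
    and \<phi> g :: "real^3 \<Rightarrow> real^3^3" and \<xi> \<eta> :: "real^3 \<Rightarrow> real^3"
  assumes "almost_paracontact_walker U f \<phi> \<xi> \<eta> g"
  shows "\<not> para_Sasakian U \<phi> \<xi> \<eta> g \<and> \<not> K_paracontact U \<phi> \<xi> \<eta> g"
proof -
  have pr: "pseudo_riemannian U g"
    using walker_almost_paracontact_metric[OF assms] unfolding almost_paracontact_metric_def by blast
  obtain a b c where U: "open U" "U \<noteq> {}"
    and sm: "smooth_on U f" "smooth_on U a" "smooth_on U b" "smooth_on U c"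
    and rel: "\<And>p. p \<in> U \<Longrightarrow> (b p)\<^sup>2 + f p * (c p)\<^sup>2 + 2 * a p * c p = 1"
    and eqs: "\<phi> = walker_phi f a b c" "\<xi> = walker_xi a b c" "\<eta> = walker_eta f a b c"
      "g = walker_metric f"
    using assms unfolding almost_paracontact_walker_def by blast
  \<comment> \<open>Both notions include \<open>paracontact_metric\<close>, so it is enough to
    refute their second conditions under it.\<close>
  have "\<not> normal_structure U \<phi> \<xi> \<eta> g \<and> \<not> killing U g \<xi>" if "paracontact_metric U \<phi> \<xi> \<eta> g"
  proof -
    interpret paracontact_walker U f a b c "\<lambda>p. a p + f p * c p"
      using paracontact_walkerI[OF U(1) sm rel] pr that unfolding eqs by blast
    show ?thesis using not_normal not_killing U(2) pr unfolding eqs by blast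
  qed
  then show ?thesis unfolding para_Sasakian_def K_paracontact_def by blast
qed

end
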